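(* Let $\hat S\in\mathcal S$ be a follower solution with an ordering $(i_1,\dots,i_T)$ of its elements. Let $A'=\{a_1,\dots,a_K\}\subseteq\hat S$ and $B'=\{b_1,\dots,b_K\}\subseteq N\setminus\hat S$ (with $a_1,\dots,a_K$ pairwise distinct and $b_1,\dots,b_K$ pairwise distinct) be such that $c^\ell_{a_k}\ge c^\ell_{b_k}$ for all $\ell=1,\dots,L$ and each $k\in\{1,\dots,K\}$. Put $\hat S_{(1)}=\emptyset$, $\hat S_{(t)}=\{i_1,\dots,i_{t-1}\}$ for $2\le t\le T$, and $B'_{(0)}=\emptyset$, $B'_{(k)}=\{b_1,\dots,b_k\}$ for $k\in\{1,\dots,K\}$. Then the alternative cut $$w\ \ge\ z(\hat S)-\sum_{t=1}^T\rho_{i_t}(\hat S_{(t)})\,x_{i_t}+\sum_{k=1}^K\rho_{b_k}\big((\hat S\cup B'_{(k-1)})\setminus\{a_k\}\big)\,(x_{a_k}-x_{b_k})$$ is valid for the single-level model $\min\{w : w\ge\Phi(x),\ Ax\le b,\ x\in\{0,1\}^n\}$, i.e. every pair $(x,w)$ with $x\in X$, $w\in\mathbb R$, $w\ge\Phi(x)$ satisfies it.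
   Context: $N$ is a finite ground set of items and $z:2^N\to\mathbb R$ is a set function that is submodular ($z(S\cup\{i\})-z(S)\ge z(T\cup\{i\})-z(T)$ for all $S\subseteq T\subseteq N$, $i\in N\setminus T$) and non-decreasing ($z(S)\le z(T)$ for $S\subseteq T\subseteq N$). The marginal gain of $i\in N$ with respect to $S\subseteq N$ is $\rho_i(S)=z(S\cup\{i\})-z(S)$. Leader: $X=\{x\in\{0,1\}^n: Ax\le b\}$, where $A$ is a real matrix and $b$ a real vector of appropriate dimensions, and $n$ is the number of leader variables; there is a leader variable $x_i$ for every item $i\in N$. For $x\in X$, $N_x=\{i\in N: x_i=1\}$ is the set of interdicted items. Follower: for $\ell=1,\dots,L$ and $i\in N$ there are costs $c_i^\ell\ge 0$ and budgets $Q_\ell\in\mathbb R$; write $C(S)\le Q$ if $\sum_{i\in S}c_i^\ell\le Q_\ell$ for all $\ell=1,\dots,L$. The set of follower solutions is $\mathcal S=\{S\subseteq N: C(S)\le Q\}$. The follower's value function is $\Phi(x)=\max\{z(S): S\subseteq N\setminus N_x,\ C(S)\le Q\}$. *)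

theory Defs
  imports "HOL-Analysis.Analysis"
begin

definition submodular_on :: "'v set \<Rightarrow> ('v set \<Rightarrow> real) \<Rightarrow> bool" where
  "submodular_on N z \<longleftrightarrow>
     (\<forall>S T. S \<subseteq> T \<longrightarrow> T \<subseteq> N \<longrightarrow>
        (\<forall>i \<in> N - T. z (S \<union> {i}) - z S \<ge> z (T \<union> {i}) - z T))"

definition marginal_gain :: "('v set \<Rightarrow> real) \<Rightarrow> 'v \<Rightarrow> 'v set \<Rightarrow> real" where
  "marginal_gain z i S = z (S \<union> {i}) - z S"

text \<open>The leader variables are indexed by the finite type \<open>'v\<close>, and the items are some of these
  indices: there may be leader variables that belong to no item.\<close>

definition leader_solutions :: "real^'v^'m \<Rightarrow> real^'m \<Rightarrow> (real^'v) set" where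
  "leader_solutions A rhs = {x. (\<forall>i. x $ i \<in> {0, 1}) \<and> A *v x \<le> rhs}"

definition interdicted :: "'v set \<Rightarrow> real^'v \<Rightarrow> 'v set" where
  "interdicted N x = {i \<in> N. x $ i = 1}"

definition within_budget ::
    "nat \<Rightarrow> (nat \<Rightarrow> 'v \<Rightarrow> real) \<Rightarrow> (nat \<Rightarrow> real) \<Rightarrow> 'v set \<Rightarrow> bool" where
  "within_budget L c Q S \<longleftrightarrow> (\<forall>l \<in> {1..L}. (\<Sum>i\<in>S. c l i) \<le> Q l)"

definition follower_solutions ::
    "'v set \<Rightarrow> nat \<Rightarrow> (nat \<Rightarrow> 'v \<Rightarrow> real) \<Rightarrow> (nat \<Rightarrow> real) \<Rightarrow> 'v set set" where
  "follower_solutions N L c Q = {S. S \<subseteq> N \<and> within_budget L c Q S}"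

text \<open>\<open>Max\<close> is unspecified on the empty set. With nonnegative costs, the set below is
  nonempty for every \<open>x\<close> as soon as there is a follower solution at all, since then the empty
  set is within budget.\<close>

definition follower_value ::
    "'v set \<Rightarrow> ('v set \<Rightarrow> real) \<Rightarrow> nat \<Rightarrow> (nat \<Rightarrow> 'v \<Rightarrow> real) \<Rightarrow> (nat \<Rightarrow> real) \<Rightarrow> real^'v \<Rightarrow> real" where
  "follower_value N z L c Q x =
     Max {z S | S. S \<subseteq> N - interdicted N x \<and> within_budget L c Q S}"

definition single_level_feasible ::
    "'v set \<Rightarrow> ('v set \<Rightarrow> real) \<Rightarrow> nat \<Rightarrow> (nat \<Rightarrow> 'v \<Rightarrow> real) \<Rightarrow> (nat \<Rightarrow> real) \<Rightarrow>
     real^'v^'m \<Rightarrow> real^'m \<Rightarrow> ((real^'v) \<times> real) set" where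
  "single_level_feasible N z L c Q A rhs =
     {(x, w). x \<in> leader_solutions A rhs \<and> w \<ge> follower_value N z L c Q x}"

end

theory Submission
  imports Defs
begin

text \<open>
  Let \<open>X\<close> be the set of interdicted items. The cut compares the value function with one concrete
  reply of the follower: keep \<open>S - X\<close> and, for every pair \<open>k\<close> whose \<open>a k\<close> has been interdicted
  while \<open>b k\<close> is still available, take \<open>b k\<close> in place of \<open>a k\<close>. Since \<open>b k\<close> costs no more than
  the lost item \<open>a k\<close>, this reply respects the budgets (\<open>within_budget_exchange\<close>), and it avoids
  \<open>X\<close> by construction, so the value function is at least its \<open>z\<close>-value.

  Its \<open>z\<close>-value is bounded from below by adding its items one at a time and replacing each marginal
  gain by the gain with respect to a larger set (\<open>sum_marginal_gain_le\<close>). Along the ordering of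
  \<open>S\<close>, the gains of the items that survive are at least their gains in the full ordering, and those
  sum up to \<open>z S - z {}\<close> minus the gains of the interdicted items. Adding then the replacements
  to \<open>S - X\<close>, the item \<open>a k\<close> is absent when \<open>b k\<close> is added, because it lies in \<open>X\<close>; hence the gain is
  at least the one with respect to \<open>S\<close> and the earlier \<open>b\<close> items without \<open>a k\<close>. In the
  last sum of the cut the chosen pairs carry the coefficient \<open>1\<close>, and all others carry
  \<open>0\<close> or \<open>-1\<close>, so by monotonicity of \<open>z\<close> they only weaken the cut.
\<close>

lemma marginal_gain_nonneg:
  assumes "mono_on (Pow N) z" and "D \<subseteq> N" and "e \<in> N"
  shows "0 \<le> marginal_gain z e D"
  using mono_onD[OF assms(1), of D "D \<union> {e}"] assms(2,3) by (auto simp: marginal_gain_def)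

lemma marginal_gain_antimono:
  assumes "submodular_on N z" and "C \<subseteq> D" and "D \<subseteq> N - {e}" and "e \<in> N"
  shows "marginal_gain z e D \<le> marginal_gain z e C"
  using assms unfolding submodular_on_def marginal_gain_def by blast

text \<open>Induction over the largest index: it is added last, so that its reference set is all of
  the rest and the reference sets of the other indices do not change.\<close>

lemma sum_marginal_gain_telescope:
  fixes I :: "nat set"
  assumes "finite I"
  shows "(\<Sum>t\<in>I. marginal_gain z (e t) (R \<union> e ` (I \<inter> {..<t}))) = z (R \<union> e ` I) - z R"
  using assms
proof (induction I rule: finite_linorder_max_induct)
  case empty
  then show ?case by simp
next
  case (insert m I)
  have "insert m I \<inter> {..<t} = I \<inter> {..<t}" if "t \<in> I" for t
    using insert.hyps(2) that by (auto dest: order.asym)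
  then have "(\<Sum>t\<in>I. marginal_gain z (e t) (R \<union> e ` (insert m I \<inter> {..<t})))
      = (\<Sum>t\<in>I. marginal_gain z (e t) (R \<union> e ` (I \<inter> {..<t})))"
    by simp
  moreover have "insert m I \<inter> {..<m} = I" and "m \<notin> I"
    using insert.hyps(2) by auto
  ultimately show ?case
    using insert.IH insert.hyps(1) by (simp add: marginal_gain_def)
qed

text \<open>Diminishing returns along a chain: every gain in the telescoping sum only decreases when its
  reference set is enlarged. This single estimate serves both halves of the cut, with \<open>D t\<close> the
  prefix of the full ordering for the survivors, and \<open>S\<close> with the earlier \<open>b\<close> items and
  without \<open>a t\<close> for the replacements.\<close>

lemma sum_marginal_gain_le:
  fixes I :: "nat set"
  assumes "submodular_on N z" and "finite I"
    and chain: "\<And>t. t \<in> I \<Longrightarrow> R \<union> e ` (I \<inter> {..<t}) \<subseteq> D t"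
    and ground: "\<And>t. t \<in> I \<Longrightarrow> D t \<subseteq> N - {e t}" "\<And>t. t \<in> I \<Longrightarrow> e t \<in> N"
  shows "(\<Sum>t\<in>I. marginal_gain z (e t) (D t)) \<le> z (R \<union> e ` I) - z R"
proof -
  have "(\<Sum>t\<in>I. marginal_gain z (e t) (D t))
      \<le> (\<Sum>t\<in>I. marginal_gain z (e t) (R \<union> e ` (I \<inter> {..<t})))"
    by (intro sum_mono marginal_gain_antimono[OF assms(1)] chain ground)
  then show ?thesis
    using sum_marginal_gain_telescope[OF assms(2)] by metis
qed

text \<open>Each element that survives the removal of \<open>X\<close> gains at least as much when the elements of \<open>X\<close>
  are missing before it as it gained in the full ordering of \<open>S\<close>. The loss caused by \<open>X\<close> is
  therefore at most the sum of the gains that its elements had in that ordering.\<close>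

lemma submodular_survivors_ge:
  fixes i :: "nat \<Rightarrow> 'v"
  assumes sub: "submodular_on N z" and "S \<subseteq> N" and ord: "bij_betw i {1..T} S"
  shows "z S - (\<Sum>t\<in>{t \<in> {1..T}. i t \<in> X}. marginal_gain z (i t) (i ` {1..<t})) \<le> z (S - X)"
proof -
  define gain where "gain t = marginal_gain z (i t) (i ` {1..<t})" for t
  define hit where "hit = {t \<in> {1..T}. i t \<in> X}"
  have img: "i ` {1..T} = S" and inj: "inj_on i {1..T}"
    using ord by (auto simp: bij_betw_def)
  have "{1..T} \<inter> {..<t} = {1..<t}" if "t \<in> {1..T}" for t
    using that by auto
  then have all: "(\<Sum>t = 1..T. gain t) = z S - z {}"
    using sum_marginal_gain_telescope[of "{1..T}" z i "{}"] img by (simp add: gain_def)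
  have "(\<Sum>t\<in>{1..T} - hit. gain t) \<le> z ({} \<union> i ` ({1..T} - hit)) - z {}"
    unfolding gain_def
  proof (rule sum_marginal_gain_le[OF sub])
    fix t assume t: "t \<in> {1..T} - hit"
    have "i t \<notin> i ` {1..<t}"
      using t by (subst inj_on_image_mem_iff[OF inj]) auto
    moreover have "i ` {1..<t} \<subseteq> i ` {1..T}"
      using t by (intro image_mono) auto
    ultimately show "i ` {1..<t} \<subseteq> N - {i t}"
      using img \<open>S \<subseteq> N\<close> by blast
    show "i t \<in> N"
      using t img \<open>S \<subseteq> N\<close> by blast
  qed auto
  moreover have "i ` ({1..T} - hit) = S - X"
    using img by (auto simp: hit_def)
  moreover have "(\<Sum>t = 1..T. gain t) = (\<Sum>t\<in>{1..T} - hit. gain t) + (\<Sum>t\<in>hit. gain t)"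
    by (rule sum.subset_diff) (auto simp: hit_def)
  ultimately show ?thesis
    using all by (simp add: gain_def hit_def)
qed

text \<open>The budget is not exceeded because the replaced items \<open>a ` P\<close> form a part of \<open>S\<close> disjoint from
  what is kept, so that their cost pays for that of the replacements.\<close>

lemma within_budget_exchange:
  fixes S :: "'v::finite set"
  assumes "within_budget L c Q S" and "R \<subseteq> S" and "a ` P \<subseteq> S - R"
    and "inj_on a P" and "finite P"
    and nonneg: "\<And>l j. l \<in> {1..L} \<Longrightarrow> j \<in> S \<union> b ` P \<Longrightarrow> 0 \<le> c l j"
    and cheaper: "\<And>l k. l \<in> {1..L} \<Longrightarrow> k \<in> P \<Longrightarrow> c l (b k) \<le> c l (a k)"
  shows "within_budget L c Q (R \<union> b ` P)"
  unfolding within_budget_def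
proof
  fix l assume l: "l \<in> {1..L}"
  have "sum (c l) (R \<union> b ` P) \<le> sum (c l) R + sum (c l) (b ` P)"
    using sum.union_inter[of R "b ` P" "c l"] sum_nonneg[of "R \<inter> b ` P" "c l"] nonneg[OF l]
    by fastforce
  also have "sum (c l) (b ` P) \<le> (\<Sum>k\<in>P. c l (b k))"
    using sum_image_le[of P "c l" b] nonneg[OF l] \<open>finite P\<close> by simp
  also have "\<dots> \<le> (\<Sum>k\<in>P. c l (a k))"
    using cheaper[OF l] by (rule sum_mono)
  also have "\<dots> = sum (c l) (a ` P)"
    using \<open>inj_on a P\<close> by (simp add: sum.reindex)
  also have "sum (c l) R + sum (c l) (a ` P) = sum (c l) (R \<union> a ` P)"
    using \<open>a ` P \<subseteq> S - R\<close> by (intro sum.union_disjoint[symmetric]) auto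
  also have "\<dots> \<le> sum (c l) S"
    using assms(2,3) nonneg[OF l] by (intro sum_mono2) auto
  also have "\<dots> \<le> Q l"
    using assms(1) l by (simp add: within_budget_def)
  finally show "sum (c l) (R \<union> b ` P) \<le> Q l"
    by simp
qed

lemma follower_value_ge:
  fixes N :: "'v::finite set"
  assumes "R \<subseteq> N - interdicted N x" and "within_budget L c Q R"
  shows "z R \<le> follower_value N z L c Q x"
  unfolding follower_value_def
proof (rule Max_ge)
  show "finite {z S |S. S \<subseteq> N - interdicted N x \<and> within_budget L c Q S}"
    by (rule finite_image_set) simp
qed (use assms in blast)

theorem theorem4:
  fixes N S :: "'v::finite set"
    and z :: "'v set \<Rightarrow> real"
    and A :: "real^'v^'m::finite" and rhs :: "real^'m"
    and L T K :: nat
    and c :: "nat \<Rightarrow> 'v \<Rightarrow> real" and Q :: "nat \<Rightarrow> real"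
    and i a b :: "nat \<Rightarrow> 'v"
  assumes "submodular_on N z"
    and "mono_on (Pow N) z"
    and "\<forall>l \<in> {1..L}. \<forall>j \<in> N. c l j \<ge> 0"
    and "S \<in> follower_solutions N L c Q"
    and "bij_betw i {1..T} S"
    and "inj_on a {1..K}" and "a ` {1..K} \<subseteq> S"
    and "inj_on b {1..K}" and "b ` {1..K} \<subseteq> N - S"
    and "\<forall>l \<in> {1..L}. \<forall>k \<in> {1..K}. c l (a k) \<ge> c l (b k)"
  shows "\<forall>(x, w) \<in> single_level_feasible N z L c Q A rhs.
    w \<ge> z S
        - (\<Sum>t = 1..T. marginal_gain z (i t) (i ` {1..<t}) * x $ i t)
        + (\<Sum>k = 1..K. marginal_gain z (b k) ((S \<union> b ` {1..k - 1}) - {a k})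
                         * (x $ a k - x $ b k))"
proof -
  have SN: "S \<subseteq> N" and budget: "within_budget L c Q S"
    using assms(4) by (auto simp: follower_solutions_def)
  let ?D = "\<lambda>k. (S \<union> b ` {1..k - 1}) - {a k}"
  have "z S - (\<Sum>t = 1..T. marginal_gain z (i t) (i ` {1..<t}) * x $ i t)
        + (\<Sum>k = 1..K. marginal_gain z (b k) (?D k) * (x $ a k - x $ b k))
      \<le> follower_value N z L c Q x"
    if x: "x \<in> leader_solutions A rhs" for x
  proof -
    define X where "X = interdicted N x"
    define P where "P = {k \<in> {1..K}. a k \<in> X \<and> b k \<notin> X}"
    have x01: "x $ j = (if j \<in> X then 1 else 0)" if "j \<in> N" for j
      using x that by (auto simp: leader_solutions_def X_def interdicted_def)
    have aS: "a k \<in> S" and bN: "b k \<in> N" and bS: "b k \<notin> S" if "k \<in> {1..K}" for k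
      using that assms(7,9) by blast+
    have iN: "i t \<in> N" if "t \<in> {1..T}" for t
      using that assms(5) SN by (auto simp: bij_betw_def)
    have DN: "?D k \<subseteq> N" if "k \<in> {1..K}" for k
      using that SN bN by auto

    have hit: "(\<Sum>t = 1..T. marginal_gain z (i t) (i ` {1..<t}) * x $ i t)
        = (\<Sum>t\<in>{t \<in> {1..T}. i t \<in> X}. marginal_gain z (i t) (i ` {1..<t}))"
      by (intro sum.mono_neutral_cong_right) (auto simp: x01 iN)

    \<comment> \<open>Outside \<open>P\<close> the coefficient is \<open>0\<close> or \<open>-1\<close>, and the gain is nonnegative.\<close>
    have "(\<Sum>k = 1..K. marginal_gain z (b k) (?D k) * (x $ a k - x $ b k))
        \<le> (\<Sum>k = 1..K. if k \<in> P then marginal_gain z (b k) (?D k) else 0)"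
    proof (rule sum_mono)
      fix k assume k: "k \<in> {1..K}"
      then have "0 \<le> marginal_gain z (b k) (?D k)"
        by (intro marginal_gain_nonneg[OF assms(2)] DN bN)
      then show "marginal_gain z (b k) (?D k) * (x $ a k - x $ b k)
          \<le> (if k \<in> P then marginal_gain z (b k) (?D k) else 0)"
        using k aS[OF k] bN[OF k] SN by (auto simp: x01 P_def)
    qed
    also have "\<dots> = (\<Sum>k\<in>P. marginal_gain z (b k) (?D k))"
      by (rule sum.mono_neutral_cong_right) (auto simp: P_def)
    also have "\<dots> \<le> z ((S - X) \<union> b ` P) - z (S - X)"
    proof (rule sum_marginal_gain_le[OF assms(1)])
      fix k assume k: "k \<in> P"
      then have kK: "k \<in> {1..K}" and "a k \<in> X"
        by (auto simp: P_def)
      have "b ` {1..k - 1} \<subseteq> b ` {1..K}"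
        using kK by (intro image_mono) auto
      then have "a k \<notin> b ` {1..k - 1}"
        using aS[OF kK] assms(9) by blast
      moreover have "P \<inter> {..<k} \<subseteq> {1..k - 1}"
        by (auto simp: P_def)
      ultimately show "(S - X) \<union> b ` (P \<inter> {..<k}) \<subseteq> ?D k"
        using \<open>a k \<in> X\<close> by blast
      have "b k \<notin> b ` {1..k - 1}"
        using kK by (subst inj_on_image_mem_iff[OF assms(8)]) auto
      then show "?D k \<subseteq> N - {b k}"
        using DN[OF kK] bS[OF kK] by blast
      show "b k \<in> N"
        using bN[OF kK] .
    qed (simp add: P_def)
    finally have swap: "(\<Sum>k = 1..K. marginal_gain z (b k) (?D k) * (x $ a k - x $ b k))
        \<le> z ((S - X) \<union> b ` P) - z (S - X)" .

    have "within_budget L c Q ((S - X) \<union> b ` P)"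
    proof (rule within_budget_exchange[OF budget])
      show "a ` P \<subseteq> S - (S - X)"
        using aS unfolding P_def by blast
      show "inj_on a P"
        using assms(6) by (rule inj_on_subset) (auto simp: P_def)
      show "0 \<le> c l j" if "l \<in> {1..L}" "j \<in> S \<union> b ` P" for l j
        using that assms(3) SN bN unfolding P_def by blast
      show "c l (b k) \<le> c l (a k)" if "l \<in> {1..L}" "k \<in> P" for l k
        using that assms(10) by (auto simp: P_def)
    qed (auto simp: P_def)
    then have "z ((S - X) \<union> b ` P) \<le> follower_value N z L c Q x"
      using SN bN unfolding P_def X_def
      by (intro follower_value_ge) (auto simp: interdicted_def)
    then show ?thesis
      using submodular_survivors_ge[OF assms(1) SN assms(5), of X] hit swap by linarith
  qed
  then show ?thesis
    unfolding single_level_feasible_def by fastforce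
qed

end
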